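(* Let $G$ be a connected graph of order $n\ge 4$ such that its complement $\overline{G}$ is connected. Then $$2|\mathrm{leaf}(G)|+2|\mathrm{leaf}(\overline{G})|\le \gamma_{tc}(M(G))+\gamma_{tc}(M(\overline{G}))\le \frac{n^2+3n-4}{2}.$$
   Context: All graphs are finite, simple and undirected; $\overline{G}$ is the complement of $G$, and $\mathrm{leaf}(H)=\{v\in V(H)\mid \deg_H(v)=1\}$. For a graph $H$, a set $D\subseteq V(H)$ is a total dominating set if every vertex of $H$ has a neighbor in $D$. A set $D\subseteq V(H)$ is a total outer-connected dominating set of $H$ if $D$ is a total dominating set and the induced subgraph $H[V(H)\setminus D]$ is connected; $\gamma_{tc}(H)$ denotes the minimum cardinality of a total outer-connected dominating set of $H$. The middle graph $M(G)$ of a graph $G$ has vertex set $V(G)\cup E(G)$, where two elements $x,y$ are adjacent iff either $x,y\in E(G)$ are edges of $G$ sharing an endpoint, or one of them is a vertex of $G$ and the other is an edge of $G$ incident to it. *)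

theory Defs
  imports Complex_Main "Graph_Theory.Graph_Theory"
begin

(* A finite simple undirected graph is a pair_graph: a finite loop-free digraph with a
   symmetric arc relation, each undirected edge {u, v} being the pair of arcs (u, v), (v, u). *)

definition graph_complement :: "'a pair_pre_digraph \<Rightarrow> 'a pair_pre_digraph" where
  "graph_complement G = \<lparr> pverts = pverts G,
     parcs = {(u, v). u \<in> pverts G \<and> v \<in> pverts G \<and> u \<noteq> v \<and> (u, v) \<notin> parcs G} \<rparr>"

(* In a symmetric digraph the out-degree of a vertex is its number of neighbours. *)
definition leaf :: "'a pair_pre_digraph \<Rightarrow> 'a set" where
  "leaf H = {v \<in> pverts H. out_degree (with_proj H) v = 1}"

definition undirected_edges :: "'a pair_pre_digraph \<Rightarrow> 'a set set" where
  "undirected_edges G = {{u, v} | u v. (u, v) \<in> parcs G}"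

definition middle_graph :: "'a pair_pre_digraph \<Rightarrow> ('a + 'a set) pair_pre_digraph" where
  "middle_graph G = \<lparr> pverts = pverts G <+> undirected_edges G,
     parcs = {(Inr e, Inr f) | e f. e \<in> undirected_edges G \<and> f \<in> undirected_edges G \<and>
                e \<noteq> f \<and> e \<inter> f \<noteq> {}}
           \<union> {(Inl v, Inr e) | v e. v \<in> pverts G \<and> e \<in> undirected_edges G \<and> v \<in> e}
           \<union> {(Inr e, Inl v) | v e. v \<in> pverts G \<and> e \<in> undirected_edges G \<and> v \<in> e} \<rparr>"

definition total_dominating_set :: "'a pair_pre_digraph \<Rightarrow> 'a set \<Rightarrow> bool" where
  "total_dominating_set H D \<longleftrightarrow>
     D \<subseteq> pverts H \<and> (\<forall>v \<in> pverts H. \<exists>u \<in> D. (v, u) \<in> parcs H)"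

(* Connectedness requires a nonempty vertex set, so D = V(H) does not qualify. *)
definition total_outer_connected_dominating_set :: "'a pair_pre_digraph \<Rightarrow> 'a set \<Rightarrow> bool" where
  "total_outer_connected_dominating_set H D \<longleftrightarrow>
     total_dominating_set H D \<and>
     Digraph_Component.connected (with_proj H \<restriction> (pverts H - D))"

definition gamma_tc :: "'a pair_pre_digraph \<Rightarrow> nat" where
  "gamma_tc H = (LEAST k. \<exists>D. total_outer_connected_dominating_set H D \<and> card D = k)"

lemma pair_graph_complement:
  assumes "pair_graph G" shows "pair_graph (graph_complement G)"
proof -
  interpret pair_graph G by fact
  have "finite (pverts G \<times> pverts G)" using pair_finite_verts by simp
  then have "finite (parcs (graph_complement G))"
    by (rule finite_subset[rotated]) (auto simp: graph_complement_def)
  then show ?thesis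
    using pair_finite_verts arcs_symmetric
    by unfold_locales (auto simp: graph_complement_def symmetric_def sym_def)
qed

lemma pair_graph_middle:
  assumes "pair_graph G" shows "pair_graph (middle_graph G)"
proof -
  interpret pair_graph G by fact
  have "undirected_edges G = (\<lambda>(u, v). {u, v}) ` parcs G"
    by (auto simp: undirected_edges_def)
  then have fin: "finite (undirected_edges G)" using pair_finite_arcs by simp
  then have finV: "finite (pverts (middle_graph G))"
    using pair_finite_verts by (simp add: middle_graph_def)
  then have "finite (pverts (middle_graph G) \<times> pverts (middle_graph G))" by simp
  then have "finite (parcs (middle_graph G))"
    by (rule finite_subset[rotated]) (auto simp: middle_graph_def)
  then show ?thesis
    using finV by unfold_locales (auto simp: middle_graph_def symmetric_def sym_def)
qed

(* The minimum defining gamma_tc (middle_graph G) is attained: V(M(G)) minus any one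
   vertex of G is a total outer-connected dominating set. *)
lemma middle_graph_tocds_ex:
  assumes "pair_graph G" and conn: "Digraph_Component.connected (with_proj G)"
    and card: "card (pverts G) \<ge> 2" and v: "v \<in> pverts G"
  shows "total_outer_connected_dominating_set (middle_graph G) (pverts (middle_graph G) - {Inl v})"
proof -
  interpret pair_graph G by fact
  let ?M = "middle_graph G"
  have nb: "\<exists>y. (x, y) \<in> parcs G" if x: "x \<in> pverts G" for x
  proof -
    obtain z where z: "z \<in> pverts G" "z \<noteq> x"
      using card x by (metis One_nat_def Suc_1 card_le_Suc0_iff_eq not_less_eq_eq pair_finite_verts)
    have "strongly_connected (with_proj G)"
      using symmetric_connected_imp_strongly_connected[OF pair_sym_arcs conn] .
    then have "x \<rightarrow>\<^sup>*\<^bsub>with_proj G\<^esub> z" using x z by (auto simp: strongly_connected_def)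
    then show ?thesis using z(2) by (auto elim: converse_reachable_cases)
  qed
  have "total_dominating_set ?M (pverts ?M - {Inl v})"
    unfolding total_dominating_set_def
  proof (intro conjI ballI)
    fix w assume w: "w \<in> pverts ?M"
    show "\<exists>u\<in>pverts ?M - {Inl v}. (w, u) \<in> parcs ?M"
    proof (cases w)
      case (Inl x)
      then have x: "x \<in> pverts G" using w by (auto simp: middle_graph_def)
      then obtain y where "(x, y) \<in> parcs G" using nb by blast
      then have "{x, y} \<in> undirected_edges G" by (auto simp: undirected_edges_def)
      then show ?thesis using Inl x
        by (intro bexI[of _ "Inr {x, y}"]) (auto simp: middle_graph_def)
    next
      case (Inr e)
      then have e: "e \<in> undirected_edges G" using w by (auto simp: middle_graph_def)
      then obtain x y where xy: "e = {x, y}" "(x, y) \<in> parcs G"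
        by (auto simp: undirected_edges_def)
      then have "x \<noteq> y" "x \<in> pverts G" "y \<in> pverts G"
        using no_loops' wellformed' by auto
      then obtain z where "z \<in> e" "z \<noteq> v" "z \<in> pverts G" using xy by auto
      then show ?thesis using Inr e
        by (intro bexI[of _ "Inl z"]) (auto simp: middle_graph_def)
    qed
  qed auto
  moreover have "pverts ?M - (pverts ?M - {Inl v}) = {Inl v}"
    using v by (auto simp: middle_graph_def)
  moreover have "Digraph_Component.connected (with_proj ?M \<restriction> {Inl v})"
    by (auto simp: Digraph_Component.connected_def strongly_connected_def reachable_def mk_symmetric_def
        intro: rtrancl_on_refl)
  ultimately show ?thesis
    by (simp add: total_outer_connected_dominating_set_def)
qed

end

theory Submission
  imports Defs
begin

text \<open>Upper bound: the set outside a total outer-connected dominating set is nonempty, so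
  \<open>\<gamma>\<^sub>t\<^sub>c (M(G))\<close> is less than the order of \<open>M(G)\<close>, which is the order plus the size of \<open>G\<close>; and the
  edges of a graph and of its complement partition the 2-element sets of vertices.

  Lower bound: let \<open>D\<close> be a total outer-connected dominating set of any graph \<open>H\<close>. The neighbour
  of a leaf is the only vertex that can dominate it, so \<open>D\<close> contains all neighbours of leaves; a
  leaf outside \<open>D\<close> is therefore isolated there, hence the only vertex outside \<open>D\<close>. So \<open>D\<close> has at
  least as many vertices as there are leaves and neighbours of leaves together, unless these
  exhaust \<open>H\<close>. In \<open>M(G)\<close> they do not: its leaves are the leaves of \<open>G\<close>, their neighbours are the
  pendant edges of \<open>G\<close>, and there are equally many of both since no two leaves are adjacent.\<close>

lemma connected_verts_subset:
  assumes conn: "Digraph_Component.connected K"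
    and v: "v \<in> A" "v \<in> verts K"
    and closed: "\<And>x y. (x, y) \<in> arcs_ends K \<Longrightarrow> x \<in> A \<longleftrightarrow> y \<in> A"
  shows "verts K \<subseteq> A"
proof
  fix w assume "w \<in> verts K"
  then have "v \<rightarrow>\<^sup>*\<^bsub>with_proj (mk_symmetric K)\<^esub> w"
    using conn v(2) by (simp add: Digraph_Component.connected_def strongly_connected_def)
  then show "w \<in> A"
    unfolding reachable_def
  proof (induction rule: rtrancl_on_induct)
    case base
    show ?case by (rule v(1))
  next
    case (step x y)
    then have "(x, y) \<in> arcs_ends K \<or> (y, x) \<in> arcs_ends K"
      by (auto simp: mk_symmetric_def arcs_ends_def arc_to_ends_def)
    with step.IH show ?case using closed by blast
  qed
qed

lemma isolated_in_connected_induce_subgraph: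
  assumes "Digraph_Component.connected (with_proj H \<restriction> S)" and "v \<in> S"
    and "\<And>w. w \<in> S \<Longrightarrow> (v, w) \<notin> parcs H \<and> (w, v) \<notin> parcs H"
  shows "S = {v}"
proof -
  have "verts (with_proj H \<restriction> S) \<subseteq> {v}"
    using assms by (intro connected_verts_subset[of _ v]) (auto simp: arcs_ends_conv)
  with \<open>v \<in> S\<close> show ?thesis by auto
qed

lemma out_degree_with_proj: "out_degree (with_proj H) v = card {u. (v, u) \<in> parcs H}"
proof -
  have "out_arcs (with_proj H) v = Pair v ` {u. (v, u) \<in> parcs H}"
    by (auto simp: out_arcs_def)
  then show ?thesis
    by (simp add: out_degree_def card_image inj_on_def)
qed

lemma leaf_iff: "v \<in> leaf H \<longleftrightarrow> v \<in> pverts H \<and> (\<exists>!u. (v, u) \<in> parcs H)"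
  by (simp add: leaf_def out_degree_with_proj card_1_singleton_iff set_eq_iff) metis

lemma leaf_in_pverts: "v \<in> leaf H \<Longrightarrow> v \<in> pverts H"
  by (simp add: leaf_def)

lemma leaf_neighbour_unique:
  "v \<in> leaf H \<Longrightarrow> (v, u) \<in> parcs H \<Longrightarrow> (v, w) \<in> parcs H \<Longrightarrow> u = w"
  by (auto simp: leaf_iff)

definition support_vertices :: "'a pair_pre_digraph \<Rightarrow> 'a set" where
  "support_vertices H = {u. \<exists>v \<in> leaf H. (v, u) \<in> parcs H}"

definition pendant_edges :: "'a pair_pre_digraph \<Rightarrow> 'a set set" where
  "pendant_edges G = {e \<in> undirected_edges G. e \<inter> leaf G \<noteq> {}}"

lemma support_vertices_subset_total_dominating_set:
  assumes "total_dominating_set H D"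
  shows "support_vertices H \<subseteq> D"
proof
  fix u assume "u \<in> support_vertices H"
  then obtain v where v: "v \<in> leaf H" "(v, u) \<in> parcs H"
    by (auto simp: support_vertices_def)
  then obtain w where w: "w \<in> D" "(v, w) \<in> parcs H"
    using assms leaf_in_pverts[OF v(1)] by (auto simp: total_dominating_set_def)
  with leaf_neighbour_unique[OF v w(2)] show "u \<in> D" by simp
qed

lemma gamma_tc_le_card:
  "total_outer_connected_dominating_set H D \<Longrightarrow> gamma_tc H \<le> card D"
  unfolding gamma_tc_def by (intro Least_le) blast

lemma gamma_tc_attained:
  assumes "\<exists>D. total_outer_connected_dominating_set H D"
  obtains D where "total_outer_connected_dominating_set H D" "card D = gamma_tc H"
proof -
  have "\<exists>D. total_outer_connected_dominating_set H D \<and> card D = gamma_tc H"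
    unfolding gamma_tc_def by (rule LeastI_ex) (use assms in blast)
  then show ?thesis using that by blast
qed

lemma gamma_tc_less_card_pverts:
  assumes D: "total_outer_connected_dominating_set H D" and fin: "finite (pverts H)"
  shows "gamma_tc H < card (pverts H)"
proof -
  have "pverts H - D \<noteq> {}"
    using D by (auto simp: total_outer_connected_dominating_set_def
        Digraph_Component.connected_def strongly_connected_def)
  then have "D \<subset> pverts H"
    using D by (auto simp: total_outer_connected_dominating_set_def total_dominating_set_def)
  then have "card D < card (pverts H)" using fin by (rule psubset_card_mono[rotated])
  with gamma_tc_le_card[OF D] show ?thesis by simp
qed

lemma pverts_graph_complement: "pverts (graph_complement G) = pverts G"
  by (simp add: graph_complement_def)

lemma pverts_middle_graph: "pverts (middle_graph G) = pverts G <+> undirected_edges G"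
  by (simp add: middle_graph_def)

context pair_graph
begin

lemma doubleton_undirected_edge_iff: "{u, v} \<in> undirected_edges G \<longleftrightarrow> (u, v) \<in> parcs G"
  using arcs_symmetric by (auto simp: undirected_edges_def doubleton_eq_iff)

lemma undirected_edge_incidentE:
  assumes "e \<in> undirected_edges G" and "v \<in> e"
  obtains u where "e = {v, u}" "(v, u) \<in> parcs G"
  using assms arcs_symmetric by (auto simp: undirected_edges_def)

lemma parcs_middle_graph_Inl:
  "(Inl v, x) \<in> parcs (middle_graph G) \<longleftrightarrow> (\<exists>u. (v, u) \<in> parcs G \<and> x = Inr {v, u})"
proof
  assume "(Inl v, x) \<in> parcs (middle_graph G)"
  then obtain e where "e \<in> undirected_edges G" "v \<in> e" "x = Inr e"
    by (auto simp: middle_graph_def)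
  then show "\<exists>u. (v, u) \<in> parcs G \<and> x = Inr {v, u}"
    by (blast elim: undirected_edge_incidentE)
next
  assume "\<exists>u. (v, u) \<in> parcs G \<and> x = Inr {v, u}"
  then obtain u where "(v, u) \<in> parcs G" "x = Inr {v, u}" by blast
  then show "(Inl v, x) \<in> parcs (middle_graph G)"
    using wellformed' by (auto simp: middle_graph_def doubleton_undirected_edge_iff)
qed

lemma undirected_edges_subset: "undirected_edges G \<subseteq> {e. e \<subseteq> pverts G \<and> card e = 2}"
proof
  fix e assume "e \<in> undirected_edges G"
  then obtain u v where "e = {u, v}" "(u, v) \<in> parcs G"
    by (auto simp: undirected_edges_def)
  moreover from this have "u \<noteq> v" "u \<in> pverts G" "v \<in> pverts G"
    using no_loops' wellformed' by auto
  ultimately show "e \<in> {e. e \<subseteq> pverts G \<and> card e = 2}" by simp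
qed

lemma finite_undirected_edges: "finite (undirected_edges G)"
  by (rule finite_subset[OF undirected_edges_subset]) simp

lemma finite_leaf: "finite (leaf G)"
  by (simp add: leaf_def)

lemma finite_pendant_edges: "finite (pendant_edges G)"
  by (simp add: pendant_edges_def finite_undirected_edges)

lemma undirected_edges_graph_complement:
  "undirected_edges (graph_complement G)
     = {e. e \<subseteq> pverts G \<and> card e = 2} - undirected_edges G"
proof -
  interpret C: pair_graph "graph_complement G"
    by (rule pair_graph_complement) unfold_locales
  have "e \<in> undirected_edges (graph_complement G) \<longleftrightarrow> e \<notin> undirected_edges G"
    if "e \<subseteq> pverts G" "card e = 2" for e
  proof -
    from \<open>card e = 2\<close> obtain u v where "e = {u, v}" "u \<noteq> v" by (auto simp: card_2_iff)
    with \<open>e \<subseteq> pverts G\<close> show ?thesis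
      unfolding \<open>e = {u, v}\<close> doubleton_undirected_edge_iff C.doubleton_undirected_edge_iff
      by (auto simp: graph_complement_def)
  qed
  then show ?thesis
    using C.undirected_edges_subset by (auto simp: pverts_graph_complement)
qed

lemma card_undirected_edges_graph_complement:
  "card (undirected_edges G) + card (undirected_edges (graph_complement G))
     = card (pverts G) choose 2"
proof -
  let ?P = "{e. e \<subseteq> pverts G \<and> card e = 2}"
  have "card (undirected_edges (graph_complement G)) = card ?P - card (undirected_edges G)"
    unfolding undirected_edges_graph_complement
    by (rule card_Diff_subset[OF finite_undirected_edges undirected_edges_subset])
  moreover have "card (undirected_edges G) \<le> card ?P"
    by (rule card_mono[OF _ undirected_edges_subset]) simp
  moreover have "card ?P = card (pverts G) choose 2" by (simp add: n_subsets)
  ultimately show ?thesis by simp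
qed

lemma finite_tocds: "total_outer_connected_dominating_set G D \<Longrightarrow> finite D"
  using finite_subset[OF _ pair_finite_verts]
  by (simp add: total_outer_connected_dominating_set_def total_dominating_set_def)

lemma Diff_tocds_eq_singleton_leaf:
  assumes D: "total_outer_connected_dominating_set G D" and v: "v \<in> leaf G" "v \<notin> D"
  shows "pverts G - D = {v}"
proof (rule isolated_in_connected_induce_subgraph)
  show "Digraph_Component.connected (with_proj G \<restriction> (pverts G - D))"
    using D by (simp add: total_outer_connected_dominating_set_def)
  show "v \<in> pverts G - D" using v leaf_in_pverts by simp
  fix w assume "w \<in> pverts G - D"
  moreover have "support_vertices G \<subseteq> D"
    using D by (intro support_vertices_subset_total_dominating_set)
      (simp add: total_outer_connected_dominating_set_def)
  ultimately have "(v, w) \<notin> parcs G" using v(1) by (auto simp: support_vertices_def)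
  then show "(v, w) \<notin> parcs G \<and> (w, v) \<notin> parcs G" using arcs_symmetric by blast
qed

lemma card_leaf_Un_support_vertices_le:
  assumes D: "total_outer_connected_dominating_set G D"
    and proper: "leaf G \<union> support_vertices G \<subset> pverts G"
  shows "card (leaf G \<union> support_vertices G) \<le> card D"
proof (cases "leaf G \<subseteq> D")
  case True
  then have "leaf G \<union> support_vertices G \<subseteq> D"
    using D by (simp add: total_outer_connected_dominating_set_def
        support_vertices_subset_total_dominating_set)
  with finite_tocds[OF D] show ?thesis by (rule card_mono)
next
  case False
  then obtain v where v: "v \<in> leaf G" "v \<notin> D" by blast
  then have "pverts G - {v} \<subseteq> D"
    using Diff_tocds_eq_singleton_leaf[OF D] by blast
  with finite_tocds[OF D] have "card (pverts G - {v}) \<le> card D" by (rule card_mono)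
  moreover have "v \<in> pverts G" using v(1) by (rule leaf_in_pverts)
  moreover have "card (leaf G \<union> support_vertices G) < card (pverts G)"
    by (rule psubset_card_mono[OF pair_finite_verts proper])
  ultimately show ?thesis by simp
qed

lemma leaves_not_adjacent:
  assumes conn: "Digraph_Component.connected (with_proj G)" and card: "card (pverts G) \<ge> 3"
    and u: "u \<in> leaf G" and v: "v \<in> leaf G"
  shows "(u, v) \<notin> parcs G"
proof
  assume uv: "(u, v) \<in> parcs G"
  have "verts (with_proj G) \<subseteq> {u, v}"
  proof (rule connected_verts_subset[OF conn])
    show "u \<in> {u, v}" "u \<in> verts (with_proj G)" using u leaf_in_pverts by auto
    fix x y assume "(x, y) \<in> arcs_ends (with_proj G)"
    then have "(x, y) \<in> parcs G" "(y, x) \<in> parcs G" using arcs_symmetric by auto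
    then show "x \<in> {u, v} \<longleftrightarrow> y \<in> {u, v}"
      using leaf_neighbour_unique u v uv arcs_symmetric[OF uv] by (metis insert_iff singletonD)
  qed
  then have "card (pverts G) \<le> card {u, v}" by (intro card_mono) auto
  also have "\<dots> \<le> 2" by (rule card_insert_le_m1) auto
  finally show False using card by simp
qed

lemma leaf_psubset_pverts:
  assumes "Digraph_Component.connected (with_proj G)" and "card (pverts G) \<ge> 3"
  shows "leaf G \<subset> pverts G"
proof -
  have "leaf G \<noteq> pverts G"
  proof
    assume all: "leaf G = pverts G"
    obtain v where v: "v \<in> leaf G" using assms(2) unfolding all by fastforce
    then obtain u where u: "(v, u) \<in> parcs G" unfolding leaf_iff by blast
    then have "u \<in> leaf G" unfolding all using wellformed' by auto
    with u v show False using leaves_not_adjacent[OF assms] by blast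
  qed
  then show ?thesis by (auto dest: leaf_in_pverts)
qed

lemma leaf_incident_edge_unique:
  assumes v: "v \<in> leaf G"
    and e: "e \<in> undirected_edges G" "v \<in> e" and e': "e' \<in> undirected_edges G" "v \<in> e'"
  shows "e = e'"
proof -
  obtain u where u: "e = {v, u}" "(v, u) \<in> parcs G" by (rule undirected_edge_incidentE[OF e])
  obtain w where w: "e' = {v, w}" "(v, w) \<in> parcs G" by (rule undirected_edge_incidentE[OF e'])
  from leaf_neighbour_unique[OF v u(2) w(2)] u(1) w(1) show ?thesis by simp
qed

lemma card_pendant_edges:
  assumes "Digraph_Component.connected (with_proj G)" and "card (pverts G) \<ge> 3"
  shows "card (pendant_edges G) = card (leaf G)"
proof (rule antisym)
  show "card (pendant_edges G) \<le> card (leaf G)"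
  proof (rule card_le_if_inj_on_rel[where r = "\<lambda>e v. v \<in> e"])
    show "finite (leaf G)" by (rule finite_leaf)
  next
    fix e assume "e \<in> pendant_edges G"
    then show "\<exists>v. v \<in> leaf G \<and> v \<in> e" by (auto simp: pendant_edges_def)
  next
    fix e e' v
    assume "e \<in> pendant_edges G" "e' \<in> pendant_edges G" "v \<in> leaf G" "v \<in> e" "v \<in> e'"
    then show "e = e'"
      by (intro leaf_incident_edge_unique[of v e e']) (simp_all add: pendant_edges_def)
  qed
next
  show "card (leaf G) \<le> card (pendant_edges G)"
  proof (rule card_le_if_inj_on_rel[where r = "\<lambda>v e. v \<in> e"])
    show "finite (pendant_edges G)" by (rule finite_pendant_edges)
  next
    fix v assume v: "v \<in> leaf G"
    then obtain u where "(v, u) \<in> parcs G" unfolding leaf_iff by blast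
    with v show "\<exists>e. e \<in> pendant_edges G \<and> v \<in> e"
      by (intro exI[of _ "{v, u}"]) (auto simp: pendant_edges_def doubleton_undirected_edge_iff)
  next
    fix u v e assume leaves: "u \<in> leaf G" "v \<in> leaf G"
      and e: "e \<in> pendant_edges G" "u \<in> e" "v \<in> e"
    then obtain w where "e = {u, w}" "(u, w) \<in> parcs G"
      by (auto simp: pendant_edges_def elim: undirected_edge_incidentE)
    with leaves e show "u = v" using leaves_not_adjacent[OF assms] by blast
  qed
qed

lemma out_degree_middle_graph_Inl:
  "out_degree (with_proj (middle_graph G)) (Inl v) = out_degree (with_proj G) v"
proof -
  have "{x. (Inl v, x) \<in> parcs (middle_graph G)} = (\<lambda>u. Inr {v, u}) ` {u. (v, u) \<in> parcs G}"
    by (auto simp: parcs_middle_graph_Inl)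
  moreover have "inj (\<lambda>u. Inr {v, u} :: 'a + 'a set)"
    by (auto simp: inj_def doubleton_eq_iff)
  ultimately show ?thesis
    by (simp add: out_degree_with_proj card_image inj_on_subset)
qed

lemma leaf_middle_graph: "leaf (middle_graph G) = Inl ` leaf G"
proof -
  have vertex: "Inl v \<in> leaf (middle_graph G) \<longleftrightarrow> v \<in> leaf G" for v
    by (auto simp: leaf_def pverts_middle_graph out_degree_middle_graph_Inl)
  have edge: "Inr e \<notin> leaf (middle_graph G)" for e
  proof
    assume leaf: "Inr e \<in> leaf (middle_graph G)"
    then have "e \<in> undirected_edges G"
      using leaf_in_pverts by (fastforce simp: pverts_middle_graph)
    moreover from this obtain u v where "e = {u, v}" "u \<noteq> v" "u \<in> pverts G" "v \<in> pverts G"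
      using undirected_edges_subset by (fastforce simp: card_2_iff)
    ultimately have "(Inr e, Inl u) \<in> parcs (middle_graph G)"
        "(Inr e, Inl v) \<in> parcs (middle_graph G)"
      by (auto simp: middle_graph_def)
    from leaf_neighbour_unique[OF leaf this] \<open>u \<noteq> v\<close> show False by simp
  qed
  show ?thesis
  proof (rule set_eqI)
    fix x show "x \<in> leaf (middle_graph G) \<longleftrightarrow> x \<in> Inl ` leaf G"
      using vertex edge by (cases x) auto
  qed
qed

lemma support_vertices_middle_graph: "support_vertices (middle_graph G) = Inr ` pendant_edges G"
proof -
  have "support_vertices (middle_graph G) = Inr ` {{v, u} | v u. v \<in> leaf G \<and> (v, u) \<in> parcs G}"
    by (auto simp: support_vertices_def leaf_middle_graph parcs_middle_graph_Inl)
  also have "{{v, u} | v u. v \<in> leaf G \<and> (v, u) \<in> parcs G} = pendant_edges G"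
    by (auto simp: pendant_edges_def doubleton_undirected_edge_iff elim: undirected_edge_incidentE)
  finally show ?thesis .
qed

lemma card_pverts_middle_graph:
  "card (pverts (middle_graph G)) = card (pverts G) + card (undirected_edges G)"
  using finite_undirected_edges by (simp add: pverts_middle_graph card_Plus)

lemma ex_tocds_middle_graph:
  assumes "Digraph_Component.connected (with_proj G)" and "card (pverts G) \<ge> 2"
  shows "\<exists>D. total_outer_connected_dominating_set (middle_graph G) D"
proof -
  obtain v where "v \<in> pverts G" using assms(2) by fastforce
  with middle_graph_tocds_ex[OF pair_graph_axioms assms] show ?thesis by blast
qed

lemma gamma_tc_middle_graph_less:
  assumes "Digraph_Component.connected (with_proj G)" and "card (pverts G) \<ge> 2"
  shows "gamma_tc (middle_graph G) < card (pverts G) + card (undirected_edges G)"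
proof -
  obtain D where "total_outer_connected_dominating_set (middle_graph G) D"
    using ex_tocds_middle_graph[OF assms] by blast
  then have "gamma_tc (middle_graph G) < card (pverts (middle_graph G))"
    by (rule gamma_tc_less_card_pverts) (simp add: pverts_middle_graph finite_undirected_edges)
  then show ?thesis by (simp only: card_pverts_middle_graph)
qed

lemma two_card_leaf_le_gamma_tc_middle_graph:
  assumes conn: "Digraph_Component.connected (with_proj G)" and card: "card (pverts G) \<ge> 3"
  shows "2 * card (leaf G) \<le> gamma_tc (middle_graph G)"
proof -
  interpret M: pair_graph "middle_graph G"
    by (rule pair_graph_middle) (rule pair_graph_axioms)
  have leaf_support: "leaf (middle_graph G) \<union> support_vertices (middle_graph G)
      = leaf G <+> pendant_edges G"
    by (auto simp: leaf_middle_graph support_vertices_middle_graph)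
  have "leaf G <+> pendant_edges G \<subset> pverts (middle_graph G)"
    using leaf_psubset_pverts[OF assms] by (auto simp: pverts_middle_graph pendant_edges_def)
  moreover have "\<exists>D. total_outer_connected_dominating_set (middle_graph G) D"
    by (rule ex_tocds_middle_graph[OF conn]) (use card in simp)
  then obtain D where D: "total_outer_connected_dominating_set (middle_graph G) D"
      "card D = gamma_tc (middle_graph G)"
    by (rule gamma_tc_attained)
  ultimately have "card (leaf G <+> pendant_edges G) \<le> gamma_tc (middle_graph G)"
    using M.card_leaf_Un_support_vertices_le[OF D(1)] by (simp add: leaf_support)
  moreover have "card (leaf G <+> pendant_edges G) = 2 * card (leaf G)"
    by (simp add: card_Plus finite_leaf finite_pendant_edges card_pendant_edges[OF assms])
  ultimately show ?thesis by simp
qed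

end

theorem theorem5p2:
  fixes G :: "'a pair_pre_digraph" and n :: nat
  assumes "pair_graph G"
    and "card (pverts G) = n"
    and "n \<ge> 4"
    and "Digraph_Component.connected (with_proj G)"
    and "Digraph_Component.connected (with_proj (graph_complement G))"
  shows "2 * card (leaf G) + 2 * card (leaf (graph_complement G))
           \<le> gamma_tc (middle_graph G) + gamma_tc (middle_graph (graph_complement G))
       \<and> real (gamma_tc (middle_graph G) + gamma_tc (middle_graph (graph_complement G)))
           \<le> (real n ^ 2 + 3 * real n - 4) / 2"
proof
  interpret pair_graph G by fact
  interpret C: pair_graph "graph_complement G"
    using assms(1) by (rule pair_graph_complement)
  let ?\<gamma> = "gamma_tc (middle_graph G)" and ?\<gamma>' = "gamma_tc (middle_graph (graph_complement G))"
  note order = assms(2,3) pverts_graph_complement[of G]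
  show "2 * card (leaf G) + 2 * card (leaf (graph_complement G)) \<le> ?\<gamma> + ?\<gamma>'"
    using two_card_leaf_le_gamma_tc_middle_graph[OF assms(4)]
      C.two_card_leaf_le_gamma_tc_middle_graph[OF assms(5)] order by simp
  have "?\<gamma> + ?\<gamma>' + 2 \<le> 2 * n + (n choose 2)"
    using gamma_tc_middle_graph_less[OF assms(4)] C.gamma_tc_middle_graph_less[OF assms(5)]
      card_undirected_edges_graph_complement order by simp
  then have "real (?\<gamma> + ?\<gamma>') + 2 \<le> 2 * real n + real (n choose 2)"
    by linarith
  moreover have "real (n choose 2) = real n * (real n - 1) / 2"
    using assms(3) by (simp add: choose_two real_of_nat_div of_nat_diff)
  ultimately show "real (?\<gamma> + ?\<gamma>') \<le> (real n ^ 2 + 3 * real n - 4) / 2"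
    by (simp add: field_simps power2_eq_square)
qed

end
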